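(* For every integer $k \geq 2$ there exist a 1-unique graph $G$ and a spanning subgraph $G'$ of $G$ such that $\operatorname{td}(G')=\operatorname{td}(G)$ and $G'$ has at least $k$ fewer edges than $G$. Hence it is possible to delete arbitrarily many edges from a 1-unique graph before obtaining a critical subgraph; that is, for every positive integer $m$ there exist a 1-unique graph $G$ and a set $S$ of at least $m$ edges of $G$ such that the spanning subgraph $G-S$ is critical and $\operatorname{td}(G-S)=\operatorname{td}(G)$.
   Context: Graphs are finite and simple (loops and parallel edges produced by edge contraction are discarded). A labeling of a graph $G$ assigns a positive integer to each vertex. A labeling is feasible if every path between two distinct vertices with the same label contains a vertex having a higher label. The tree-depth $\operatorname{td}(G)$ is the smallest $k$ for which $G$ has a feasible labeling with labels from $\{1,\dots,k\}$. A graph $G$ is critical if every proper minor of $G$ has tree-depth strictly less than $\operatorname{td}(G)$. A graph $G$ is 1-unique if for every vertex $v$ of $G$ there is a feasible labeling of $G$ with labels from $\{1,\dots,\operatorname{td}(G)\}$ in which $v$ is the unique vertex receiving the label 1. *)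

theory Defs
  imports Main
begin

text \<open>
  A graph is a pair of a vertex set and a set of edges, each edge being the two-element set
  of its ends. Loops and parallel edges are thus excluded by \<open>simple_graph\<close>.
\<close>

type_synonym 'a graph = "'a set \<times> 'a set set"

abbreviation verts :: "'a graph \<Rightarrow> 'a set" where
  "verts G \<equiv> fst G"

abbreviation edges :: "'a graph \<Rightarrow> 'a set set" where
  "edges G \<equiv> snd G"

definition simple_graph :: "'a graph \<Rightarrow> bool" where
  "simple_graph G \<longleftrightarrow>
     finite (verts G) \<and> (\<forall>e\<in>edges G. e \<subseteq> verts G \<and> card e = 2)"

definition spanning_subgraph :: "'a graph \<Rightarrow> 'a graph \<Rightarrow> bool" where
  "spanning_subgraph H G \<longleftrightarrow> verts H = verts G \<and> edges H \<subseteq> edges G"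

definition delete_edges :: "'a graph \<Rightarrow> 'a set set \<Rightarrow> 'a graph" where
  "delete_edges G S = (verts G, edges G - S)"

definition delete_vertex :: "'a graph \<Rightarrow> 'a \<Rightarrow> 'a graph" where
  "delete_vertex G v = (verts G - {v}, {e \<in> edges G. v \<notin> e})"

text \<open>
  Contraction of the edge \<open>{u, v}\<close>: the merged vertex keeps the name \<open>u\<close>. The edge itself
  becomes the loop \<open>{u}\<close>, which is removed; parallel edges coincide as sets.
\<close>

definition contract_edge :: "'a graph \<Rightarrow> 'a \<Rightarrow> 'a \<Rightarrow> 'a graph" where
  "contract_edge G u v =
     (verts G - {v}, (\<lambda>e. (\<lambda>x. if x = v then u else x) ` e) ` edges G - {{u}})"

inductive minor_step :: "'a graph \<Rightarrow> 'a graph \<Rightarrow> bool" where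
  vertex_deletion: "v \<in> verts G \<Longrightarrow> minor_step G (delete_vertex G v)"
| edge_deletion: "e \<in> edges G \<Longrightarrow> minor_step G (delete_edges G {e})"
| edge_contraction: "{u, v} \<in> edges G \<Longrightarrow> u \<noteq> v \<Longrightarrow> minor_step G (contract_edge G u v)"

text \<open>
  \<open>proper_minor G H\<close>: \<open>H\<close> arises from \<open>G\<close> by one or more operations. On simple graphs each
  operation decreases the number of vertices plus the number of edges.
\<close>

definition proper_minor :: "'a graph \<Rightarrow> 'a graph \<Rightarrow> bool" where
  "proper_minor = minor_step\<^sup>+\<^sup>+"

definition is_path :: "'a graph \<Rightarrow> 'a list \<Rightarrow> bool" where
  "is_path G p \<longleftrightarrow>
     p \<noteq> [] \<and> distinct p \<and> set p \<subseteq> verts G \<and> successively (\<lambda>x y. {x, y} \<in> edges G) p"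

definition feasible :: "'a graph \<Rightarrow> ('a \<Rightarrow> nat) \<Rightarrow> bool" where
  "feasible G f \<longleftrightarrow>
     (\<forall>v\<in>verts G. 0 < f v) \<and>
     (\<forall>p. is_path G p \<and> hd p \<noteq> last p \<and> f (hd p) = f (last p) \<longrightarrow>
          (\<exists>w\<in>set p. f (hd p) < f w))"

definition tree_depth :: "'a graph \<Rightarrow> nat" where
  "tree_depth G = (LEAST k. \<exists>f. feasible G f \<and> f ` verts G \<subseteq> {1..k})"

definition critical :: "'a graph \<Rightarrow> bool" where
  "critical G \<longleftrightarrow> (\<forall>H. proper_minor G H \<longrightarrow> tree_depth H < tree_depth G)"

definition one_unique :: "'a graph \<Rightarrow> bool" where
  "one_unique G \<longleftrightarrow>
     (\<forall>v\<in>verts G. \<exists>f. feasible G f \<and> f ` verts G \<subseteq> {1..tree_depth G} \<and>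
        {w \<in> verts G. f w = 1} = {v})"

end

theory Submission imports Defs begin

text \<open>
  A labeling of a 1-unique graph in which \<open>v\<close> is the only vertex labeled 1 shows that deleting
  \<open>v\<close>, or contracting an edge at \<open>v\<close>, lowers the tree-depth. A spanning subgraph of the same
  tree-depth is again 1-unique, so an edge-minimal one is critical, and the second claim follows
  from the first. For the first claim, a 5-cycle with a chord is 1-unique and has the same
  tree-depth 4 as the 5-cycle. Joining two disjoint 1-unique graphs of tree-depth \<open>n\<close> by a bridge
  yields a 1-unique graph of tree-depth \<open>n + 1\<close>, and the number of superfluous edges doubles.
\<close>

section \<open>Feasibility and reachability\<close>

abbreviation adj :: "'a graph \<Rightarrow> 'a \<Rightarrow> 'a \<Rightarrow> bool" where
  "adj G \<equiv> \<lambda>x y. {x, y} \<in> edges G"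

text \<open>The closure of this relation follows walks whose labels never exceed \<open>c\<close>.
  Such walks can be concatenated and mapped freely, without the distinctness that
  \<open>is_path\<close> demands.\<close>

definition le_adj :: "'a graph \<Rightarrow> ('a \<Rightarrow> nat) \<Rightarrow> nat \<Rightarrow> 'a \<Rightarrow> 'a \<Rightarrow> bool" where
  "le_adj G f c x y \<longleftrightarrow> {x, y} \<in> edges G \<and> f x \<le> c \<and> f y \<le> c"

lemma le_adj_rtranclp_sym:
  assumes "(le_adj G f c)\<^sup>*\<^sup>* x y"
  shows "(le_adj G f c)\<^sup>*\<^sup>* y x"
proof -
  have "symp (le_adj G f c)"
    by (auto simp: symp_def le_adj_def insert_commute)
  then show ?thesis using assms by (metis symp_rtranclp sympD)
qed

lemma edge_verts:
  assumes "simple_graph G" "{x, y} \<in> edges G"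
  shows "x \<in> verts G" "y \<in> verts G" "x \<noteq> y"
  using assms unfolding simple_graph_def by (auto simp: card_2_iff doubleton_eq_iff)

lemma simple_graph_finite_edges:
  assumes "simple_graph G"
  shows "finite (edges G)"
proof (rule finite_subset)
  show "edges G \<subseteq> Pow (verts G)" using assms by (auto simp: simple_graph_def)
  show "finite (Pow (verts G))" using assms by (simp add: simple_graph_def)
qed

lemma path_imp_le_adj:
  assumes "successively (\<lambda>x y. {x, y} \<in> edges G) p" "p \<noteq> []" "\<forall>w\<in>set p. f w \<le> c"
  shows "(le_adj G f c)\<^sup>*\<^sup>* (hd p) (last p)"
  using assms
proof (induction p rule: induct_list012)
  case (3 x y zs)
  then have "le_adj G f c x y" by (auto simp: le_adj_def)
  with 3 show ?case by (auto intro: converse_rtranclp_into_rtranclp)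
qed auto

lemma le_adj_imp_path:
  assumes "simple_graph G" "(le_adj G f c)\<^sup>*\<^sup>* x y" "x \<in> verts G" "f x \<le> c"
  shows "\<exists>p. is_path G p \<and> hd p = x \<and> last p = y \<and> (\<forall>w\<in>set p. f w \<le> c)"
  using assms(2)
proof (induction rule: rtranclp_induct)
  case base
  show ?case by (rule exI[of _ "[x]"]) (use assms in \<open>auto simp: is_path_def\<close>)
next
  case (step y z)
  then obtain p where p: "is_path G p" "hd p = x" "last p = y" "\<forall>w\<in>set p. f w \<le> c" by blast
  have yz: "{y, z} \<in> edges G" "f z \<le> c" using step(2) by (auto simp: le_adj_def)
  have z: "z \<in> verts G" using edge_verts[OF assms(1) yz(1)] by simp
  show ?case
  proof (cases "z \<in> set p")
    case True
    \<comment> \<open>The walk returns to a vertex already on the path, so the path is cut right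
      after that vertex instead of being extended.\<close>
    then obtain us vs where "p = us @ z # vs" by (meson split_list)
    then have "p = (us @ [z]) @ vs" by simp
    then show ?thesis using p
      by (intro exI[of _ "us @ [z]"]) (auto simp: is_path_def successively_append_iff hd_append)
  next
    case False
    then show ?thesis using p yz z
      by (intro exI[of _ "p @ [z]"]) (auto simp: is_path_def successively_append_iff)
  qed
qed

text \<open>A path violating feasibility has all its labels bounded by the label of its ends, so it
  is a walk for \<open>le_adj\<close>; conversely such a walk shortens to a path. Feasibility thus
  means that equally labeled vertices lie in different components once all higher labels are
  removed.\<close>

lemma feasible_iff:
  assumes "simple_graph G"
  shows "feasible G f \<longleftrightarrow> (\<forall>v\<in>verts G. 0 < f v) \<and>
    (\<forall>x\<in>verts G. \<forall>y\<in>verts G. x \<noteq> y \<and> f x = f y \<longrightarrow> \<not> (le_adj G f (f x))\<^sup>*\<^sup>* x y)"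
    (is "_ \<longleftrightarrow> _ \<and> ?R")
proof -
  have R: "?R" if "feasible G f"
  proof (intro ballI impI notI)
    fix x y assume xy: "x \<in> verts G" "x \<noteq> y \<and> f x = f y" "(le_adj G f (f x))\<^sup>*\<^sup>* x y"
    then obtain p where "is_path G p" "hd p = x" "last p = y" "\<forall>w\<in>set p. f w \<le> f x"
      using le_adj_imp_path[OF assms] by blast
    then show False using that xy(2) unfolding feasible_def by (metis not_less)
  qed
  have path: "\<exists>w\<in>set p. f (hd p) < f w"
    if "?R" "is_path G p" "hd p \<noteq> last p" "f (hd p) = f (last p)" for p
  proof (rule ccontr)
    assume "\<not> ?thesis"
    then have "(le_adj G f (f (hd p)))\<^sup>*\<^sup>* (hd p) (last p)"
      using that(2) by (intro path_imp_le_adj) (auto simp: is_path_def not_less)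
    moreover have "hd p \<in> verts G" "last p \<in> verts G"
      using that(2) by (auto simp: is_path_def)
    ultimately show False using that by blast
  qed
  show ?thesis
  proof (intro iffI conjI)
    assume "feasible G f"
    then show "\<forall>v\<in>verts G. 0 < f v" unfolding feasible_def by (rule conjunct1)
  next
    assume "(\<forall>v\<in>verts G. 0 < f v) \<and> ?R"
    then show "feasible G f" unfolding feasible_def using path by meson
  qed (rule R)
qed

section \<open>Tree-depth and minors\<close>

lemma tree_depth_le:
  assumes "feasible G f" "f ` verts G \<subseteq> {1..k}"
  shows "tree_depth G \<le> k"
  unfolding tree_depth_def using assms by (intro Least_le) blast

text \<open>The least number is attained because some labeling exists at all: an injective one is
  feasible, as no path between distinct vertices has equally labeled ends.\<close>

lemma tree_depth_labeling:
  assumes "finite (verts G)"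
  obtains f where "feasible G f" "f ` verts G \<subseteq> {1..tree_depth G}"
proof -
  obtain h :: "'a \<Rightarrow> nat" where h: "inj_on h (verts G)"
    using finite_imp_inj_to_nat_seg[OF assms] by blast
  have "feasible G (\<lambda>x. Suc (h x))"
  proof -
    have "hd p = last p" if "is_path G p" "h (hd p) = h (last p)" for p
      using that h by (auto simp: is_path_def inj_on_def subset_iff)
    then show ?thesis by (auto simp: feasible_def)
  qed
  moreover have "(\<lambda>x. Suc (h x)) ` verts G \<subseteq> {1..Suc (Max (h ` verts G))}"
    using assms by auto
  ultimately have "\<exists>k f. feasible G f \<and> f ` verts G \<subseteq> {1..k}" by blast
  then have "\<exists>f. feasible G f \<and> f ` verts G \<subseteq> {1..tree_depth G}"
    unfolding tree_depth_def by (rule LeastI_ex)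
  then show thesis using that by blast
qed

lemma feasible_mono:
  assumes "feasible G f" "verts H \<subseteq> verts G" "edges H \<subseteq> edges G"
  shows "feasible H f"
proof -
  have "is_path G p" if "is_path H p" for p
    using that assms by (auto simp: is_path_def intro: successively_mono)
  then show ?thesis using assms unfolding feasible_def by blast
qed

lemma tree_depth_mono:
  assumes "finite (verts G)" "verts H \<subseteq> verts G" "edges H \<subseteq> edges G"
  shows "tree_depth H \<le> tree_depth G"
proof -
  obtain f where "feasible G f" "f ` verts G \<subseteq> {1..tree_depth G}"
    using tree_depth_labeling[OF assms(1)] .
  then show ?thesis using assms by (intro tree_depth_le[of _ f]) (auto intro: feasible_mono)
qed

lemma simple_graph_subgraph:
  assumes "simple_graph G" "verts H = verts G" "edges H \<subseteq> edges G"
  shows "simple_graph H"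
  using assms unfolding simple_graph_def by auto

lemma simple_graph_contract:
  assumes "simple_graph G" "{u, v} \<in> edges G"
  shows "simple_graph (contract_edge G u v)"
proof -
  note uv = edge_verts[OF assms]
  let ?h = "\<lambda>x. if x = v then u else x"
  have "?h ` e \<subseteq> verts G - {v} \<and> card (?h ` e) = 2" if "e \<in> edges G" "?h ` e \<noteq> {u}" for e
  proof -
    have e: "e \<subseteq> verts G" "card e = 2" using assms(1) that(1) by (auto simp: simple_graph_def)
    then obtain x y where xy: "e = {x, y}" "x \<noteq> y" by (meson card_2_iff)
    have im: "?h ` e = {?h x, ?h y}" by (simp add: xy)
    \<comment> \<open>Distinct ends can only collapse if they are \<open>u\<close> and
      \<open>v\<close>, and then the image is the discarded loop \<open>{u}\<close>.\<close>
    have "?h x \<noteq> ?h y" using that(2) xy(2) unfolding im by (auto split: if_splits)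
    moreover have "?h x \<in> verts G - {v}" "?h y \<in> verts G - {v}" using e(1) xy uv by auto
    ultimately show ?thesis unfolding im by simp
  qed
  moreover have "finite (verts G - {v})" using assms(1) by (simp add: simple_graph_def)
  ultimately show ?thesis unfolding simple_graph_def contract_edge_def by simp blast
qed

lemma simple_graph_minor_step:
  assumes "minor_step G H" "simple_graph G"
  shows "simple_graph H"
  using assms(1)
proof cases
  case (edge_contraction u v)
  then show ?thesis using simple_graph_contract[OF assms(2)] by metis
qed (use assms(2) in \<open>auto simp: simple_graph_def delete_vertex_def delete_edges_def\<close>)

text \<open>Giving the merged vertex the larger of the two labels lets every bounded walk of the
  contraction lift to \<open>G\<close> with the same bound: where the merged vertex is allowed, both
  \<open>u\<close> and \<open>v\<close> are.\<close>

lemma feasible_contract: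
  assumes G: "simple_graph G" and e: "{u, v} \<in> edges G" and f: "feasible G f"
  shows "feasible (contract_edge G u v) (f(u := max (f u) (f v)))"
proof -
  let ?H = "contract_edge G u v" and ?g = "f(u := max (f u) (f v))"
  let ?h = "\<lambda>x. if x = v then u else x"
  note uv = edge_verts[OF G e]
  have pos: "\<forall>x\<in>verts G. 0 < f x"
    and no: "\<And>x y. x \<in> verts G \<Longrightarrow> y \<in> verts G \<Longrightarrow> x \<noteq> y \<Longrightarrow> f x = f y \<Longrightarrow>
      \<not> (le_adj G f (f x))\<^sup>*\<^sup>* x y"
    using f unfolding feasible_iff[OF G] by blast+
  \<comment> \<open>The edge comes from an edge \<open>{x, y}\<close> of \<open>G\<close>, with
    \<open>s\<close> and \<open>t\<close> the images of \<open>x\<close> and \<open>y\<close>. If an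
    end was \<open>v\<close>, a detour along \<open>{u, v}\<close> repairs the walk, and the bound
    on the maximum keeps it within \<open>c\<close>.\<close>
  have step: "(le_adj G f c)\<^sup>*\<^sup>* s t" if "le_adj ?H ?g c s t" for s t c
  proof -
    have st: "{s, t} \<in> edges ?H" "?g s \<le> c" "?g t \<le> c" using that by (auto simp: le_adj_def)
    then obtain d where d: "d \<in> edges G" "{s, t} = ?h ` d" by (auto simp: contract_edge_def)
    then obtain x0 y0 where d0: "d = {x0, y0}"
      using G unfolding simple_graph_def by (metis card_2_iff)
    have "{s, t} = {?h x0, ?h y0}" unfolding d(2) d0 by simp
    then have "s = ?h x0 \<and> t = ?h y0 \<or> s = ?h y0 \<and> t = ?h x0" by (simp only: doubleton_eq_iff)
    moreover have "{x0, y0} \<in> edges G" "{y0, x0} \<in> edges G"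
      using d(1) d0 by (simp_all add: insert_commute)
    ultimately obtain x y where xy: "{x, y} \<in> edges G" "s = ?h x" "t = ?h y" by blast
    have fx: "f x \<le> c" "f y \<le> c" "s = u \<Longrightarrow> f u \<le> c \<and> f v \<le> c" "t = u \<Longrightarrow> f u \<le> c \<and> f v \<le> c"
      using st xy uv by (auto split: if_splits)
    have "(le_adj G f c)\<^sup>*\<^sup>* s x"
      using xy(2) fx(3) e by (auto simp: le_adj_def split: if_splits)
    also have "(le_adj G f c)\<^sup>*\<^sup>* x y" using xy fx by (auto simp: le_adj_def)
    also have "(le_adj G f c)\<^sup>*\<^sup>* y t"
      using xy(3) fx(4) e by (auto simp: le_adj_def insert_commute split: if_splits)
    finally show ?thesis .
  qed
  have reach: "(le_adj G f c)\<^sup>*\<^sup>* s t" if "(le_adj ?H ?g c)\<^sup>*\<^sup>* s t" for s t c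
    using that by induction (auto dest: step)
  \<comment> \<open>The maximum equals \<open>f u\<close> or \<open>f v\<close>. Both
    \<open>u\<close> and \<open>v\<close> reach \<open>y\<close>, so whichever attains it conflicts
    with \<open>y\<close> already in \<open>G\<close>.\<close>
  have u_case: False
    if "(le_adj ?H ?g (?g u))\<^sup>*\<^sup>* u y" "y \<in> verts G" "y \<noteq> u" "y \<noteq> v" "?g u = ?g y" for y
  proof -
    have *: "(le_adj G f (f y))\<^sup>*\<^sup>* u y" "f y = max (f u) (f v)" using reach[OF that(1)] that by auto
    have "(le_adj G f (f y))\<^sup>*\<^sup>* v u"
      using e *(2) by (auto simp: le_adj_def insert_commute)
    then have **: "(le_adj G f (f y))\<^sup>*\<^sup>* v y" using *(1) by simp
    show False
      using no[of u y] no[of v y] uv * ** that by (cases "f u \<le> f v") (auto simp: max_def)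
  qed
  have "\<not> (le_adj ?H ?g (?g x))\<^sup>*\<^sup>* x y"
    if "x \<in> verts ?H" "y \<in> verts ?H" "x \<noteq> y" "?g x = ?g y" for x y
  proof
    assume r: "(le_adj ?H ?g (?g x))\<^sup>*\<^sup>* x y"
    have xy: "x \<in> verts G" "y \<in> verts G" "x \<noteq> v" "y \<noteq> v"
      using that by (auto simp: contract_edge_def)
    consider "x = u" | "y = u" | "x \<noteq> u" "y \<noteq> u" by blast
    then show False
    proof cases
      case 1
      then show False using u_case[of y] r xy that by metis
    next
      case 2
      then show False using u_case[of x] le_adj_rtranclp_sym[OF r] xy that by metis
    next
      case 3
      then show False using no[of x y] reach[OF r] xy that by simp
    qed
  qed
  moreover have "\<forall>x\<in>verts ?H. 0 < ?g x" using pos uv by (auto simp: contract_edge_def)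
  ultimately show ?thesis unfolding feasible_iff[OF simple_graph_contract[OF G e]] by blast
qed

lemma tree_depth_minor_step:
  assumes "minor_step G H" "simple_graph G"
  shows "tree_depth H \<le> tree_depth G"
  using assms(1)
proof cases
  case (edge_contraction u v)
  obtain f where f: "feasible G f" "f ` verts G \<subseteq> {1..tree_depth G}"
    using tree_depth_labeling assms(2) simple_graph_def by metis
  have "(f(u := max (f u) (f v))) ` verts H \<subseteq> {1..tree_depth G}"
    using f(2) edge_verts[OF assms(2) edge_contraction(2)] edge_contraction(1)
    by (auto simp: contract_edge_def image_subset_iff)
  with feasible_contract[OF assms(2) edge_contraction(2) f(1)] show ?thesis
    unfolding edge_contraction(1) by (rule tree_depth_le)
qed (use assms(2) in \<open>auto intro!: tree_depth_mono
      simp: simple_graph_def delete_vertex_def delete_edges_def\<close>)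

lemma tree_depth_minor:
  assumes "minor_step\<^sup>*\<^sup>* G H" "simple_graph G"
  shows "simple_graph H \<and> tree_depth H \<le> tree_depth G"
  using assms
proof induction
  case (step H K)
  then show ?case
    using simple_graph_minor_step tree_depth_minor_step by (meson order_trans)
qed simp

text \<open>Lowering all labels by one keeps their order and frees the top label. The assumption
  \<open>0 < k\<close> matters for the empty graph, whose label range is vacuously bounded.\<close>

lemma tree_depth_less:
  assumes "feasible G f" "f ` verts G \<subseteq> {2..k}" "0 < k"
  shows "tree_depth G < k"
proof -
  have "feasible G (\<lambda>x. f x - 1)"
    unfolding feasible_def
  proof (intro conjI allI impI)
    show "\<forall>v\<in>verts G. 0 < f v - 1" using assms(2) by fastforce
  next
    fix p assume p: "is_path G p \<and> hd p \<noteq> last p \<and> f (hd p) - 1 = f (last p) - 1"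
    then have "set p \<subseteq> verts G" "p \<noteq> []" by (auto simp: is_path_def)
    then have "hd p \<in> verts G" "last p \<in> verts G" by auto
    then have "2 \<le> f (hd p)" "2 \<le> f (last p)" using assms(2) by auto
    then have "f (hd p) = f (last p)" using p by linarith
    then obtain w where "w \<in> set p" "f (hd p) < f w" using assms(1) p by (auto simp: feasible_def)
    then show "\<exists>w\<in>set p. f (hd p) - 1 < f w - 1" using \<open>2 \<le> f (hd p)\<close>
      by (intro bexI[of _ w]) auto
  qed
  moreover have "(\<lambda>x. f x - 1) ` verts G \<subseteq> {1..k - 1}"
    using assms(2) by (fastforce simp: image_subset_iff)
  ultimately have "tree_depth G \<le> k - 1" by (rule tree_depth_le)
  then show ?thesis using assms(3) by linarith
qed

section \<open>Consequences of 1-uniqueness for minors and critical subgraphs\<close>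

lemma one_unique_labeling:
  assumes "one_unique G" "v \<in> verts G"
  obtains f where "feasible G f" "f ` verts G \<subseteq> {1..tree_depth G}" "f v = 1"
    "f ` (verts G - {v}) \<subseteq> {2..tree_depth G}" "0 < tree_depth G"
proof -
  obtain f where f: "feasible G f" "f ` verts G \<subseteq> {1..tree_depth G}" "{w \<in> verts G. f w = 1} = {v}"
    using assms unfolding one_unique_def by blast
  have "f w \<in> {2..tree_depth G}" if "w \<in> verts G - {v}" for w
  proof -
    have "f w \<noteq> 1" "f w \<in> {1..tree_depth G}" using that f by auto
    then show ?thesis by auto
  qed
  moreover have "f v = 1" using f(3) by blast
  moreover have "0 < tree_depth G" using f(2) assms(2) by force
  ultimately show thesis using that f by blast
qed

text \<open>The labelings of \<open>G\<close> remain feasible after edges are removed, and equal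
  tree-depth keeps the permitted range of labels the same.\<close>

lemma one_unique_spanning_subgraph:
  assumes "one_unique G" "verts H = verts G" "edges H \<subseteq> edges G" "tree_depth H = tree_depth G"
  shows "one_unique H"
  using assms unfolding one_unique_def by (metis feasible_mono order_refl)

lemma one_unique_delete_vertex:
  assumes "one_unique G" "v \<in> verts G"
  shows "tree_depth (delete_vertex G v) < tree_depth G"
proof -
  obtain f where f: "feasible G f" "f ` (verts G - {v}) \<subseteq> {2..tree_depth G}" "0 < tree_depth G"
    using one_unique_labeling[OF assms] by metis
  then show ?thesis
    by (intro tree_depth_less[of _ f]) (auto intro: feasible_mono simp: delete_vertex_def)
qed

lemma one_unique_contract:
  assumes "one_unique G" "simple_graph G" "{u, v} \<in> edges G"
  shows "tree_depth (contract_edge G u v) < tree_depth G"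
proof -
  note uv = edge_verts[OF assms(2,3)]
  obtain f where f: "feasible G f" "f ` (verts G - {v}) \<subseteq> {2..tree_depth G}" "f v = 1"
    "0 < tree_depth G"
    using one_unique_labeling[OF assms(1) uv(2)] by metis
  have "f u \<in> {2..tree_depth G}" using f uv by blast
  \<comment> \<open>As \<open>f v = 1\<close>, the maximum at the merged vertex is
    \<open>f u\<close>. The labeling is unchanged and its only 1 disappears with
    \<open>v\<close>.\<close>
  then have "f(u := max (f u) (f v)) = f" using f(3) by (auto simp: max_def)
  then have "feasible (contract_edge G u v) f" using feasible_contract[OF assms(2,3) f(1)] by simp
  then show ?thesis
    using f by (intro tree_depth_less[of _ f]) (auto simp: contract_edge_def)
qed

text \<open>Only the first minor operation has to lower the tree-depth, since later ones never raise
  it. 1-uniqueness settles vertex deletions and contractions, which leaves single edge deletions as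
  the hypothesis.\<close>

lemma one_unique_critical:
  assumes "one_unique G" "simple_graph G"
    "\<And>e. e \<in> edges G \<Longrightarrow> tree_depth (delete_edges G {e}) < tree_depth G"
  shows "critical G"
  unfolding critical_def proper_minor_def
proof (intro allI impI)
  fix H assume "minor_step\<^sup>+\<^sup>+ G H"
  then obtain K where K: "minor_step G K" "minor_step\<^sup>*\<^sup>* K H" by (meson tranclpD)
  have "tree_depth K < tree_depth G"
    using K(1)
  proof cases
    case (vertex_deletion v)
    then show ?thesis using one_unique_delete_vertex[OF assms(1)] by metis
  next
    case (edge_deletion e)
    then show ?thesis using assms(3) by metis
  next
    case (edge_contraction u v)
    then show ?thesis using one_unique_contract[OF assms(1,2)] by metis
  qed
  then show "tree_depth H < tree_depth G"
    using tree_depth_minor[OF K(2)] simple_graph_minor_step[OF K(1) assms(2)] by linarith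
qed

lemma critical_spanning_subgraph:
  assumes G: "simple_graph G" "one_unique G" and H: "spanning_subgraph H G"
    "tree_depth H = tree_depth G"
  obtains S where "edges G - edges H \<subseteq> S" "S \<subseteq> edges G" "critical (delete_edges G S)"
    "tree_depth (delete_edges G S) = tree_depth G"
proof -
  let ?P = "\<lambda>F. F \<subseteq> edges H \<and> tree_depth (verts G, F) = tree_depth G"
  have H': "verts H = verts G" "edges H \<subseteq> edges G" using H by (auto simp: spanning_subgraph_def)
  have fin: "finite (edges G)" using G(1) by (rule simple_graph_finite_edges)
  have "(verts G, edges H) = H" using H'(1) by (simp add: prod_eq_iff)
  then have PH: "?P (edges H)" using H(2) by simp
  \<comment> \<open>A smallest edge set inside \<open>edges H\<close> that keeps the tree-depth:
    removing any further edge must lower it. Staying inside \<open>edges H\<close> ensures that all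
    of \<open>edges G - edges H\<close> is deleted.\<close>
  obtain F where F: "?P F" "\<And>F'. ?P F' \<Longrightarrow> card F \<le> card F'"
    using ex_has_least_nat[of ?P, OF PH, of card] by blast
  let ?S = "edges G - F"
  have FG: "F \<subseteq> edges G" using F H' by auto
  then have del: "delete_edges G ?S = (verts G, F)" by (auto simp: delete_edges_def)
  have simple: "simple_graph (verts G, F)" by (rule simple_graph_subgraph[OF G(1)]) (use FG in auto)
  have "critical (verts G, F)"
  proof (rule one_unique_critical)
    show "one_unique (verts G, F)"
      by (rule one_unique_spanning_subgraph[OF G(2)]) (use F FG in auto)
    fix e assume e: "e \<in> edges (verts G, F)"
    have "\<not> ?P (F - {e})"
    proof
      assume "?P (F - {e})"
      from F(2)[OF this] show False
        using e FG fin by (metis card_Diff1_less finite_subset not_less snd_conv)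
    qed
    then have "tree_depth (verts G, F - {e}) \<noteq> tree_depth G" using F(1) by auto
    moreover have "tree_depth (verts G, F - {e}) \<le> tree_depth (verts G, F)"
      using G(1) by (intro tree_depth_mono) (auto simp: simple_graph_def)
    ultimately show "tree_depth (delete_edges (verts G, F) {e}) < tree_depth (verts G, F)"
      using F(1) by (auto simp: delete_edges_def)
  qed (fact simple)
  then show thesis using that[of ?S] F FG del by auto
qed

section \<open>Joining two graphs by a bridge\<close>

definition bridge_join :: "'a graph \<Rightarrow> 'a graph \<Rightarrow> 'a \<Rightarrow> 'a \<Rightarrow> 'a graph" where
  "bridge_join A B a b = (verts A \<union> verts B, edges A \<union> edges B \<union> {{a, b}})"

lemma bridge_join_commute: "bridge_join A B a b = bridge_join B A b a"
  by (auto simp: bridge_join_def insert_commute)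

lemma simple_graph_bridge_join:
  assumes "simple_graph A" "simple_graph B" "verts A \<inter> verts B = {}" "a \<in> verts A" "b \<in> verts B"
  shows "simple_graph (bridge_join A B a b)"
proof -
  have "a \<noteq> b" using assms by blast
  then show ?thesis using assms by (auto simp: simple_graph_def bridge_join_def)
qed

text \<open>The end \<open>b\<close> of the bridge carries the new top label and thereby separates
  \<open>A\<close> from the rest of \<open>B\<close>. The two sides can then reuse the same labels,
  and the label 1 survives only at \<open>v\<close>.\<close>

lemma bridge_join_labeling:
  assumes A: "simple_graph A" "one_unique A" "tree_depth A = n"
    and B: "simple_graph B" "one_unique B" "tree_depth B = n"
    and AB: "verts A \<inter> verts B = {}" "a \<in> verts A" "b \<in> verts B" "v \<in> verts A"
  shows "\<exists>f. feasible (bridge_join A B a b) f \<and> f ` verts (bridge_join A B a b) \<subseteq> {1..Suc n} \<and>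
    {w \<in> verts (bridge_join A B a b). f w = 1} = {v}"
proof -
  let ?G = "bridge_join A B a b"
  have G: "simple_graph ?G" using A B AB by (intro simple_graph_bridge_join) auto
  obtain fA where fA: "feasible A fA" "fA ` verts A \<subseteq> {1..n}" "fA v = 1"
    "fA ` (verts A - {v}) \<subseteq> {2..n}" "0 < n"
    using one_unique_labeling[OF A(2) AB(4)] A(3) by metis
  obtain fB where fB: "feasible B fB" "fB ` (verts B - {b}) \<subseteq> {2..n}"
    using one_unique_labeling[OF B(2) AB(3)] B(3) by metis
  \<comment> \<open>\<open>fB\<close> comes from 1-uniqueness at \<open>b\<close>, so raising
    \<open>b\<close> to \<open>Suc n\<close> leaves \<open>B\<close> without the label 1.\<close>
  define g where "g x = (if x \<in> verts A then fA x else if x = b then Suc n else fB x)" for x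
  have gA: "g x = fA x" "g x \<in> {1..n}" "x \<noteq> v \<Longrightarrow> g x \<noteq> 1" "x \<noteq> b" if "x \<in> verts A" for x
    using that fA(2,4) AB by (fastforce simp: g_def image_subset_iff)+
  have gB: "g x = fB x" "g x \<in> {2..n}" if "x \<in> verts B" "x \<noteq> b" for x
    using that fB(2) AB by (auto simp: g_def image_subset_iff)
  have gb: "g b = Suc n" using AB by (auto simp: g_def)
  have gV: "g x \<in> {1..Suc n}" "g x = 1 \<longleftrightarrow> x = v" "g x = Suc n \<longleftrightarrow> x = b"
    if x: "x \<in> verts ?G" for x
  proof -
    consider "x \<in> verts A" | "x \<in> verts B" "x \<noteq> b" | "x = b"
      using x by (auto simp: bridge_join_def)
    then have "g x \<in> {1..Suc n} \<and> (g x = 1 \<longleftrightarrow> x = v) \<and> (g x = Suc n \<longleftrightarrow> x = b)"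
    proof cases
      case 1
      then show ?thesis using gA[OF 1] fA(3) by auto
    next
      case 2
      then show ?thesis using gB[OF 2] AB by auto
    next
      case 3
      then show ?thesis using gb fA(5) AB by auto
    qed
    then show "g x \<in> {1..Suc n}" "g x = 1 \<longleftrightarrow> x = v" "g x = Suc n \<longleftrightarrow> x = b" by auto
  qed
  \<comment> \<open>Labels at most \<open>n\<close> exclude \<open>b\<close> and with it the bridge,
    so each step stays on one side.\<close>
  have edge: "x \<noteq> b \<and> y \<noteq> b \<and> ({x, y} \<in> edges A \<and> x \<in> verts A \<and> y \<in> verts A \<or>
      {x, y} \<in> edges B \<and> x \<in> verts B \<and> y \<in> verts B)"
    if "le_adj ?G g c x y" "c \<le> n" for c x y
  proof -
    have "{x, y} \<in> edges A \<or> {x, y} \<in> edges B \<or> {x, y} = {a, b}" "x \<noteq> b" "y \<noteq> b"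
      using that gb by (auto simp: le_adj_def bridge_join_def)
    then show ?thesis using edge_verts[OF A(1), of x y] edge_verts[OF B(1), of x y]
      by (auto simp: doubleton_eq_iff)
  qed
  have inA: "y \<in> verts A \<and> (le_adj A fA c)\<^sup>*\<^sup>* x y"
    if "(le_adj ?G g c)\<^sup>*\<^sup>* x y" "c \<le> n" "x \<in> verts A" for c x y
    using that(1)
  proof induction
    case (step y z)
    then have "z \<in> verts A" "{y, z} \<in> edges A" using edge[OF step(2) that(2)] AB by auto
    moreover have "le_adj A fA c y z"
      using step calculation gA(1) by (auto simp: le_adj_def)
    ultimately show ?case using step by auto
  qed (use that in auto)
  have inB: "y \<in> verts B \<and> y \<noteq> b \<and> (le_adj B fB c)\<^sup>*\<^sup>* x y"
    if "(le_adj ?G g c)\<^sup>*\<^sup>* x y" "c \<le> n" "x \<in> verts B" "x \<noteq> b" for c x y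
    using that(1)
  proof induction
    case (step y z)
    then have "z \<in> verts B" "{y, z} \<in> edges B" "z \<noteq> b" using edge[OF step(2) that(2)] AB by auto
    moreover have "le_adj B fB c y z"
      using step calculation gB(1) by (auto simp: le_adj_def)
    ultimately show ?case using step by auto
  qed (use that in auto)
  have "\<not> (le_adj ?G g (g x))\<^sup>*\<^sup>* x y"
    if xy: "x \<in> verts ?G" "y \<in> verts ?G" "x \<noteq> y" "g x = g y" for x y
  proof
    assume r: "(le_adj ?G g (g x))\<^sup>*\<^sup>* x y"
    \<comment> \<open>The label \<open>Suc n\<close> occurs only at \<open>b\<close>, so two equally
      labeled vertices have a label at most \<open>n\<close> and the walk stays on one side.\<close>
    have "x \<noteq> b" using gV(3) xy by metis
    then have le: "g x \<le> n" using gV(1,3)[OF xy(1)] by auto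
    show False
    proof (cases "x \<in> verts A")
      case True
      then show False
        using inA[OF r le True] xy(3,4) gA(1) fA(1) unfolding feasible_iff[OF A(1)] by metis
    next
      case False
      then have "x \<in> verts B" using xy by (auto simp: bridge_join_def)
      then show False
        using inB[OF r le _ \<open>x \<noteq> b\<close>] xy(3,4) gB(1) fB(1) \<open>x \<noteq> b\<close>
        unfolding feasible_iff[OF B(1)] by metis
    qed
  qed
  then have "feasible ?G g" unfolding feasible_iff[OF G] using gV(1) by force
  moreover have "{w \<in> verts ?G. g w = 1} = {v}"
    using gV(2) AB by (auto simp: bridge_join_def)
  ultimately show ?thesis using gV(1) by blast
qed

text \<open>If \<open>n\<close> labels sufficed, each side would have to use the label
  \<open>n\<close>. The join is connected, so two vertices with this highest label would be joined
  by a path without a higher one.\<close>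

lemma tree_depth_bridge_join_ge:
  assumes A: "simple_graph A" "n \<le> tree_depth A" and B: "simple_graph B" "n \<le> tree_depth B"
    and AB: "verts A \<inter> verts B = {}" "a \<in> verts A" "b \<in> verts B"
    and con: "\<forall>x\<in>verts (bridge_join A B a b). \<forall>y\<in>verts (bridge_join A B a b).
      (adj (bridge_join A B a b))\<^sup>*\<^sup>* x y"
  shows "Suc n \<le> tree_depth (bridge_join A B a b)"
proof (rule ccontr)
  let ?G = "bridge_join A B a b"
  assume "\<not> ?thesis"
  then have le: "tree_depth ?G \<le> n" by simp
  have G: "simple_graph ?G" using A B AB by (intro simple_graph_bridge_join)
  obtain f where f: "feasible ?G f" "f ` verts ?G \<subseteq> {1..tree_depth ?G}"
    using tree_depth_labeling G simple_graph_def by metis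
  have fn: "1 \<le> f x" "f x \<le> n" if "x \<in> verts ?G" for x using f(2) le that by force+
  \<comment> \<open>A side that avoids \<open>n\<close> would be labeled from \<open>n - 1\<close>
    labels, fewer than its tree-depth.\<close>
  have top: "\<exists>x\<in>verts C. f x = n" if "C = A \<or> C = B" for C
  proof (rule ccontr)
    assume no: "\<not> ?thesis"
    have sub: "verts C \<subseteq> verts ?G" "edges C \<subseteq> edges ?G"
      using that by (auto simp: bridge_join_def)
    have "f x \<in> {1..n - 1}" if "x \<in> verts C" for x
    proof -
      have "f x \<noteq> n" "1 \<le> f x" "f x \<le> n" using no that fn sub(1) by auto
      then show ?thesis by simp
    qed
    then have "tree_depth C \<le> n - 1"
      using feasible_mono[OF f(1) sub] by (intro tree_depth_le[of _ f]) auto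
    moreover have "0 < n" using fn[of a] AB by (auto simp: bridge_join_def)
    ultimately show False using that A(2) B(2) by auto
  qed
  obtain x y where xy: "x \<in> verts A" "f x = n" "y \<in> verts B" "f y = n" using top by metis
  then have mem: "x \<in> verts ?G" "y \<in> verts ?G" "x \<noteq> y"
    using AB by (auto simp: bridge_join_def)
  have "(adj ?G)\<^sup>*\<^sup>* x y" using con mem by blast
  then have "(le_adj ?G f n)\<^sup>*\<^sup>* x y"
  proof (rule rtranclp_mono[THEN predicate2D, rotated], intro predicate2I)
    fix s t assume "adj ?G s t"
    then show "le_adj ?G f n s t"
      using edge_verts[OF G, of s t] fn by (auto simp: le_adj_def)
  qed
  then show False using f(1) mem xy unfolding feasible_iff[OF G] by metis
qed

text \<open>Every vertex reaches \<open>a\<close> and is reached from it, across the bridge if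
  necessary. The lower bound for the tree-depth of a join relies on this connectivity.\<close>

lemma adj_bridge_join_connected:
  assumes A: "\<forall>x\<in>verts A. \<forall>y\<in>verts A. (adj A)\<^sup>*\<^sup>* x y"
    and B: "\<forall>x\<in>verts B. \<forall>y\<in>verts B. (adj B)\<^sup>*\<^sup>* x y"
    and ab: "a \<in> verts A" "b \<in> verts B"
    and xy: "x \<in> verts (bridge_join A B a b)" "y \<in> verts (bridge_join A B a b)"
  shows "(adj (bridge_join A B a b))\<^sup>*\<^sup>* x y"
proof -
  let ?R = "(adj (bridge_join A B a b))\<^sup>*\<^sup>*"
  have lift: "?R s t" if "(adj A)\<^sup>*\<^sup>* s t \<or> (adj B)\<^sup>*\<^sup>* s t" for s t
    using that rtranclp_mono[of "adj A" "adj (bridge_join A B a b)"]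
      rtranclp_mono[of "adj B" "adj (bridge_join A B a b)"]
    by (auto simp: bridge_join_def)
  have ab': "?R a b" "?R b a" by (auto simp: bridge_join_def insert_commute)
  have "?R x a \<and> ?R a x" if "x \<in> verts (bridge_join A B a b)" for x
  proof (cases "x \<in> verts A")
    case True
    then show ?thesis using A ab lift by blast
  next
    case False
    then have "?R x b" "?R b x" using that B ab lift by (auto simp: bridge_join_def)
    then show ?thesis using ab' by (meson rtranclp_trans)
  qed
  then show ?thesis using xy by (meson rtranclp_trans)
qed

section \<open>The 5-cycle with a chord\<close>

abbreviation cycle5 :: "'a \<Rightarrow> 'a \<Rightarrow> 'a \<Rightarrow> 'a \<Rightarrow> 'a \<Rightarrow> 'a graph" where
  "cycle5 p q r s t \<equiv> ({p, q, r, s, t}, {{p, q}, {q, r}, {r, s}, {s, t}, {t, p}})"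

text \<open>The chord \<open>{p, r}\<close> splits the 5-cycle into the triangle
  \<open>p q r\<close> and the square \<open>p r s t\<close>.\<close>

abbreviation house :: "'a \<Rightarrow> 'a \<Rightarrow> 'a \<Rightarrow> 'a \<Rightarrow> 'a \<Rightarrow> 'a graph" where
  "house p q r s t \<equiv> ({p, q, r, s, t}, {{p, q}, {q, r}, {r, s}, {s, t}, {t, p}, {p, r}})"

lemma cycle5_connected:
  assumes "x \<in> verts (cycle5 p q r s t)" "y \<in> verts (cycle5 p q r s t)"
  shows "(adj (cycle5 p q r s t))\<^sup>*\<^sup>* x y"
proof -
  let ?R = "(adj (cycle5 p q r s t))\<^sup>*\<^sup>*"
  have step: "?R p q" "?R q r" "?R r s" "?R s t" "?R t p" by (intro r_into_rtranclp; simp)+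
  have "?R p x \<and> ?R x p" if "x \<in> verts (cycle5 p q r s t)" for x
    using that step by simp (meson rtranclp_trans rtranclp.rtrancl_refl)
  then show ?thesis using assms by (meson rtranclp_trans)
qed

text \<open>The top label occurs once, and removing its vertex leaves a path on four vertices, which
  two labels cannot serve. The formal proof instead collects the constraints from paths with two,
  three and four vertices and checks all labelings from three labels.\<close>

lemma tree_depth_cycle5_ge:
  assumes "distinct [p, q, r, s, t]"
  shows "4 \<le> tree_depth (cycle5 p q r s t)"
proof (rule ccontr)
  let ?G = "cycle5 p q r s t"
  assume "\<not> ?thesis"
  then have le: "tree_depth ?G \<le> 3" by simp
  obtain f where f: "feasible ?G f" "f ` verts ?G \<subseteq> {1..tree_depth ?G}"
    using tree_depth_labeling[of ?G] by auto
  have bounds: "\<forall>x\<in>{p, q, r, s, t}. 1 \<le> f x \<and> f x \<le> 3" using f(2) le by force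
  have path: "\<exists>w\<in>set xs. f (hd xs) < f w"
    if "is_path ?G xs" "hd xs \<noteq> last xs" "f (hd xs) = f (last xs)" for xs
    using f(1) that unfolding feasible_def by blast
  have 1: "f p \<noteq> f q" "f q \<noteq> f r" "f r \<noteq> f s" "f s \<noteq> f t" "f t \<noteq> f p"
    using path[of "[p, q]"] path[of "[q, r]"] path[of "[r, s]"] path[of "[s, t]"] path[of "[t, p]"]
      assms by (auto simp: is_path_def)
  have 2: "f p = f r \<Longrightarrow> f p < f q" "f q = f s \<Longrightarrow> f q < f r" "f r = f t \<Longrightarrow> f r < f s"
    "f s = f p \<Longrightarrow> f s < f t" "f t = f q \<Longrightarrow> f t < f p"
    using path[of "[p, q, r]"] path[of "[q, r, s]"] path[of "[r, s, t]"] path[of "[s, t, p]"]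
      path[of "[t, p, q]"] assms by (auto simp: is_path_def)
  have 3: "f p = f s \<Longrightarrow> f p < f q \<or> f p < f r" "f q = f t \<Longrightarrow> f q < f r \<or> f q < f s"
    "f r = f p \<Longrightarrow> f r < f s \<or> f r < f t" "f s = f q \<Longrightarrow> f s < f t \<or> f s < f p"
    "f t = f r \<Longrightarrow> f t < f p \<or> f t < f q"
    using path[of "[p, q, r, s]"] path[of "[q, r, s, t]"] path[of "[r, s, t, p]"]
      path[of "[s, t, p, q]"] path[of "[t, p, q, r]"] assms by (auto simp: is_path_def)
  have "f x = 1 \<or> f x = 2 \<or> f x = 3" if "x \<in> {p, q, r, s, t}" for x using bounds that by force
  then have "f p = 1 \<or> f p = 2 \<or> f p = 3" "f q = 1 \<or> f q = 2 \<or> f q = 3"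
    "f r = 1 \<or> f r = 2 \<or> f r = 3" "f s = 1 \<or> f s = 2 \<or> f s = 3" "f t = 1 \<or> f t = 2 \<or> f t = 3"
    by blast+
  then show False using 1 2 3 by (elim disjE) simp_all
qed

text \<open>The label 2 is shared by \<open>a\<close> and \<open>b\<close>, and all others are used
  once. The only possible neighbors of \<open>a\<close> are \<open>c\<close> and \<open>d\<close>,
  labeled 3 and 4, so \<open>a\<close> is isolated among the labels at most 2; \<open>b\<close> may
  still be adjacent to \<open>v\<close>.\<close>

lemma five_vertex_labeling:
  assumes G: "simple_graph G" "verts G = {v, a, b, c, d}" "distinct [v, a, b, c, d]"
    and a: "{a, v} \<notin> edges G" "{a, b} \<notin> edges G"
  shows "\<exists>f. feasible G f \<and> f ` verts G \<subseteq> {1..4} \<and> {w \<in> verts G. f w = 1} = {v}"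
proof -
  define f :: "'a \<Rightarrow> nat" where
    "f x = (if x = v then 1 else if x = a \<or> x = b then 2 else if x = c then 3 else 4)" for x
  have a_alone: "\<not> le_adj G f 2 a x" for x
    using a edge_verts[OF G(1), of a x] G(2,3) by (auto simp: le_adj_def f_def)
  have "\<not> (le_adj G f (f x))\<^sup>*\<^sup>* x y"
    if "x \<in> verts G" "y \<in> verts G" "x \<noteq> y" "f x = f y" for x y
  proof
    assume r: "(le_adj G f (f x))\<^sup>*\<^sup>* x y"
    have "x = a \<and> y = b \<or> x = b \<and> y = a" and "f x = 2"
      using that G(2,3) by (auto simp: f_def split: if_splits)
    then have "(le_adj G f 2)\<^sup>*\<^sup>* a b" using r le_adj_rtranclp_sym by metis
    then show False using a_alone G(3) by (auto elim: converse_rtranclpE)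
  qed
  then have "feasible G f" unfolding feasible_iff[OF G(1)] by (auto simp: f_def)
  then show ?thesis using G(2,3) by (intro exI[of _ f]) (auto simp: f_def)
qed

text \<open>For each \<open>v\<close> some vertex is adjacent neither to \<open>v\<close> nor to a
  further vertex: \<open>s\<close> or \<open>t\<close> serves for \<open>p\<close>, \<open>q\<close>
  and \<open>r\<close>, while \<open>q\<close> serves for \<open>s\<close> and
  \<open>t\<close>.\<close>

lemma house_labeling:
  assumes "distinct [p, q, r, s, t]" "v \<in> verts (house p q r s t)"
  shows "\<exists>f. feasible (house p q r s t) f \<and> f ` verts (house p q r s t) \<subseteq> {1..4} \<and>
    {w \<in> verts (house p q r s t). f w = 1} = {v}"
proof -
  have G: "simple_graph (house p q r s t)" using assms(1) by (auto simp: simple_graph_def)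
  consider "v = p" | "v = q" | "v = r" | "v = s" | "v = t" using assms(2) by auto
  then show ?thesis
  proof cases
    case 1
    show ?thesis by (rule five_vertex_labeling[OF G, of v s q r t])
      (use 1 assms(1) in \<open>auto simp: doubleton_eq_iff\<close>)
  next
    case 2
    show ?thesis by (rule five_vertex_labeling[OF G, of v s p r t])
      (use 2 assms(1) in \<open>auto simp: doubleton_eq_iff\<close>)
  next
    case 3
    show ?thesis by (rule five_vertex_labeling[OF G, of v t q p s])
      (use 3 assms(1) in \<open>auto simp: doubleton_eq_iff\<close>)
  next
    case 4
    show ?thesis by (rule five_vertex_labeling[OF G, of v q t p r])
      (use 4 assms(1) in \<open>auto simp: doubleton_eq_iff\<close>)
  next
    case 5
    show ?thesis by (rule five_vertex_labeling[OF G, of v q s p r])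
      (use 5 assms(1) in \<open>auto simp: doubleton_eq_iff\<close>)
  qed
qed

section \<open>Superfluous edges\<close>

text \<open>The labelings bound the tree-depth of \<open>G\<close> from above and \<open>H\<close>
  bounds it from below, so all values coincide with \<open>n\<close>.\<close>

lemma one_unique_tree_depthI:
  assumes "simple_graph G" "verts G \<noteq> {}" "verts H = verts G" "edges H \<subseteq> edges G" "n \<le> tree_depth H"
    and "\<And>v. v \<in> verts G \<Longrightarrow>
      \<exists>f. feasible G f \<and> f ` verts G \<subseteq> {1..n} \<and> {w \<in> verts G. f w = 1} = {v}"
  shows "one_unique G \<and> tree_depth G = n \<and> tree_depth H = n"
proof -
  have "tree_depth G \<le> n" using assms(2,6) tree_depth_le by (metis ex_in_conv)
  moreover have "tree_depth H \<le> tree_depth G"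
    using assms(1,3,4) by (intro tree_depth_mono) (auto simp: simple_graph_def)
  ultimately have "tree_depth G = n" "tree_depth H = n" using assms(5) by auto
  then show ?thesis using assms(6) by (auto simp: one_unique_def)
qed

text \<open>The bound \<open>N\<close> on the vertices makes room for a disjoint second copy.\<close>

lemma superfluous_edges:
  "\<exists>(G :: nat graph) H. simple_graph G \<and> verts G \<noteq> {} \<and> verts G \<subseteq> {N..} \<and>
     verts H = verts G \<and> edges H \<subseteq> edges G \<and> (\<forall>x\<in>verts H. \<forall>y\<in>verts H. (adj H)\<^sup>*\<^sup>* x y) \<and>
     one_unique G \<and> tree_depth G = j + 4 \<and> tree_depth H = j + 4 \<and>
     2 ^ j \<le> card (edges G - edges H)"
proof (induction j arbitrary: N)
  case 0
  let ?G = "house N (N + 1) (N + 2) (N + 3) (N + 4)"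
  let ?H = "cycle5 N (N + 1) (N + 2) (N + 3) (N + 4)"
  have d: "distinct [N, N + 1, N + 2, N + 3, N + 4]" by simp
  have G: "simple_graph ?G" by (auto simp: simple_graph_def)
  have td: "one_unique ?G \<and> tree_depth ?G = 4 \<and> tree_depth ?H = 4"
    using G tree_depth_cycle5_ge[OF d] house_labeling[OF d] by (intro one_unique_tree_depthI) auto
  have "edges ?G - edges ?H = {{N, N + 2}}" by (auto simp: doubleton_eq_iff)
  then have card: "2 ^ 0 \<le> card (edges ?G - edges ?H)"
    by (metis card_1_singleton_iff One_nat_def order_refl power_0)
  have con: "\<forall>x\<in>verts ?H. \<forall>y\<in>verts ?H. (adj ?H)\<^sup>*\<^sup>* x y"
    by (intro ballI) (rule cycle5_connected)
  show ?case
    by (rule exI[of _ ?G], rule exI[of _ ?H]) (intro conjI; use G td card con in \<open>force\<close>)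
next
  case (Suc j)
  obtain A A' :: "nat graph" where A: "simple_graph A" "verts A \<noteq> {}" "verts A \<subseteq> {N..}"
    "verts A' = verts A" "edges A' \<subseteq> edges A" "\<forall>x\<in>verts A'. \<forall>y\<in>verts A'. (adj A')\<^sup>*\<^sup>* x y"
    "one_unique A" "tree_depth A = j + 4" "tree_depth A' = j + 4"
    "2 ^ j \<le> card (edges A - edges A')"
    using Suc[of N] by blast
  \<comment> \<open>Beyond all vertices of \<open>A\<close> the induction hypothesis supplies a
    disjoint second pair \<open>B\<close>, \<open>B'\<close>.\<close>
  obtain M where M: "N \<le> M" "\<forall>x\<in>verts A. x < M"
  proof
    have fin: "finite (verts A)" using A(1) by (simp add: simple_graph_def)
    then show "\<forall>x\<in>verts A. x < N + Suc (Max (verts A))"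
      using Max_ge[OF fin] by (auto intro!: le_imp_less_Suc trans_le_add2)
  qed simp
  obtain B B' :: "nat graph" where B: "simple_graph B" "verts B \<noteq> {}" "verts B \<subseteq> {M..}"
    "verts B' = verts B" "edges B' \<subseteq> edges B" "\<forall>x\<in>verts B'. \<forall>y\<in>verts B'. (adj B')\<^sup>*\<^sup>* x y"
    "one_unique B" "tree_depth B = j + 4" "tree_depth B' = j + 4"
    "2 ^ j \<le> card (edges B - edges B')"
    using Suc[of M] by blast
  obtain a b where ab: "a \<in> verts A" "b \<in> verts B" using A(2) B(2) by blast
  have disj: "verts A \<inter> verts B = {}" using M B(3) by fastforce
  let ?G = "bridge_join A B a b" and ?H = "bridge_join A' B' a b"
  have G: "simple_graph ?G" using A B disj ab by (intro simple_graph_bridge_join)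
  have simple': "simple_graph A'" "simple_graph B'"
    using A B simple_graph_subgraph by blast+
  have con: "\<forall>x\<in>verts ?H. \<forall>y\<in>verts ?H. (adj ?H)\<^sup>*\<^sup>* x y"
    using adj_bridge_join_connected[OF A(6) B(6), of a b] A(4) B(4) ab by simp
  have sub: "verts ?H = verts ?G" "edges ?H \<subseteq> edges ?G"
    using A(4,5) B(4,5) by (auto simp: bridge_join_def)
  have td: "one_unique ?G \<and> tree_depth ?G = Suc (j + 4) \<and> tree_depth ?H = Suc (j + 4)"
  proof (rule one_unique_tree_depthI)
    show "Suc (j + 4) \<le> tree_depth ?H"
      using simple' A(4,9) B(4,9) ab disj con by (intro tree_depth_bridge_join_ge) auto
    fix v assume "v \<in> verts ?G"
    then consider "v \<in> verts A" | "v \<in> verts B" by (auto simp: bridge_join_def)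
    then show "\<exists>f. feasible ?G f \<and> f ` verts ?G \<subseteq> {1..Suc (j + 4)} \<and> {w \<in> verts ?G. f w = 1} = {v}"
    proof cases
      case 1
      then show ?thesis using A B ab disj by (intro bridge_join_labeling)
    next
      case 2
      \<comment> \<open>The labeling lemma expects \<open>v\<close> on the first side, so the sides
        are exchanged.\<close>
      then show ?thesis unfolding bridge_join_commute[of A]
        using A B ab disj by (intro bridge_join_labeling) auto
    qed
  qed (use G sub ab in \<open>auto simp: bridge_join_def\<close>)
  have eA: "e \<subseteq> verts A \<and> e \<noteq> {}" if "e \<in> edges A" for e
    using A(1) that by (auto simp: simple_graph_def)
  have eB: "e \<subseteq> verts B \<and> e \<noteq> {}" if "e \<in> edges B" for e
    using B(1) that by (auto simp: simple_graph_def)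
  have disjE: "edges A \<inter> edges B = {}" "{a, b} \<notin> edges A" "{a, b} \<notin> edges B"
    using eA eB disj ab by blast+
  have fin: "finite (edges A)" "finite (edges B)"
    using A(1) B(1) by (auto intro: simple_graph_finite_edges)
  have "edges ?G - edges ?H = (edges A - edges A') \<union> (edges B - edges B')"
    using disjE A(5) B(5) by (auto simp: bridge_join_def)
  also have "card \<dots> = card (edges A - edges A') + card (edges B - edges B')"
    using disjE fin by (intro card_Un_disjoint) auto
  finally have "2 ^ Suc j \<le> card (edges ?G - edges ?H)" using A(10) B(10) by simp
  moreover have "verts ?G \<noteq> {}" "verts ?G \<subseteq> {N..}"
    using A(2,3) B(3) M(1) by (auto simp: bridge_join_def)
  ultimately show ?case using G td con sub
    by (intro exI[of _ ?G] exI[of _ ?H]) simp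
qed

theorem theorem3p3:
  "(\<forall>k::nat. k \<ge> 2 \<longrightarrow>
      (\<exists>(G :: nat graph) G'. simple_graph G \<and> one_unique G \<and> spanning_subgraph G' G \<and>
         tree_depth G' = tree_depth G \<and> card (edges G') + k \<le> card (edges G))) \<and>
   (\<forall>m::nat. m \<ge> 1 \<longrightarrow>
      (\<exists>(G :: nat graph) S. simple_graph G \<and> one_unique G \<and> S \<subseteq> edges G \<and> card S \<ge> m \<and>
         critical (delete_edges G S) \<and> tree_depth (delete_edges G S) = tree_depth G))"
proof -
  have main: "\<exists>(G :: nat graph) H. simple_graph G \<and> one_unique G \<and> spanning_subgraph H G \<and>
      tree_depth H = tree_depth G \<and> finite (edges G) \<and> k \<le> card (edges G - edges H)" for k
  proof -
    obtain G H :: "nat graph" where GH: "simple_graph G" "one_unique G" "verts H = verts G"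
      "edges H \<subseteq> edges G" "tree_depth H = tree_depth G" "2 ^ k \<le> card (edges G - edges H)"
      using superfluous_edges[of 0 k] by metis
    have "finite (edges G)" using GH(1) by (rule simple_graph_finite_edges)
    \<comment> \<open>The index \<open>k\<close> itself is large enough because
      \<open>k < 2 ^ k\<close>.\<close>
    moreover have "k \<le> card (edges G - edges H)"
      using GH(6) less_exp[of k] by linarith
    ultimately show ?thesis using GH unfolding spanning_subgraph_def by blast
  qed
  show ?thesis
  proof (intro conjI allI impI)
    fix k :: nat
    obtain G H :: "nat graph" where GH: "simple_graph G" "one_unique G" "spanning_subgraph H G"
      "tree_depth H = tree_depth G" "finite (edges G)" "k \<le> card (edges G - edges H)"
      using main[of k] by blast
    have "edges H \<subseteq> edges G" using GH(3) by (simp add: spanning_subgraph_def)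
    then have "card (edges H) + k \<le> card (edges G)"
      using GH(5,6) card_Diff_subset[of "edges H" "edges G"] card_mono[of "edges G" "edges H"]
        finite_subset[of "edges H" "edges G"] by linarith
    then show "\<exists>(G :: nat graph) G'. simple_graph G \<and> one_unique G \<and> spanning_subgraph G' G \<and>
        tree_depth G' = tree_depth G \<and> card (edges G') + k \<le> card (edges G)"
      using GH by blast
  next
    fix m :: nat
    obtain G H :: "nat graph" where GH: "simple_graph G" "one_unique G" "spanning_subgraph H G"
      "tree_depth H = tree_depth G" "finite (edges G)" "m \<le> card (edges G - edges H)"
      using main[of m] by blast
    \<comment> \<open>The critical subgraph is sought below \<open>H\<close>, so \<open>S\<close>
      contains the \<open>m\<close> edges or more that \<open>H\<close> already lacks.\<close>
    obtain S where S: "edges G - edges H \<subseteq> S" "S \<subseteq> edges G" "critical (delete_edges G S)"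
      "tree_depth (delete_edges G S) = tree_depth G"
      using critical_spanning_subgraph[OF GH(1-4)] .
    have "m \<le> card S"
      using GH(5,6) S(1,2) card_mono[of S "edges G - edges H"] finite_subset[of S "edges G"] by linarith
    then show "\<exists>(G :: nat graph) S. simple_graph G \<and> one_unique G \<and> S \<subseteq> edges G \<and> card S \<ge> m \<and>
        critical (delete_edges G S) \<and> tree_depth (delete_edges G S) = tree_depth G"
      using GH(1,2) S by blast
  qed
qed

end
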